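(* $$\sum_{n=1}^{\infty}\binom{2n}{n}\binom{2n+2}{n+1}\frac{1}{16^n(n+1)(2n+1)(2n+3)}=\frac{20}{\pi}+\frac{8G}{\pi}-\frac{26}{3},$$ where $G$ denotes Catalan's constant.
   Context: Catalan's constant is $G:=\sum_{n=0}^{\infty}\frac{(-1)^n}{(2n+1)^2}\approx 0.915965$. $\binom{n}{m}$ denotes the usual binomial coefficient for non-negative integers $n,m$. *)

theory Defs
  imports "HOL-Analysis.Analysis"
begin

definition catalan_constant :: real where
  "catalan_constant = (\<Sum>n. (-1) ^ n / (2 * real n + 1) ^ 2)"

lemma summable_catalan_constant:
  "summable (\<lambda>n. (-1) ^ n / (2 * real n + 1) ^ 2 :: real)"
proof (rule summable_comparison_test')
  show "summable (\<lambda>n. inverse (real (Suc n) ^ 2))"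
    using inverse_power_summable[of 2, where 'a = real] by (subst summable_Suc_iff) simp
  show "norm ((-1) ^ n / (2 * real n + 1) ^ 2 :: real) \<le> inverse (real (Suc n) ^ 2)" if "n \<ge> 0" for n
  proof -
    have "real (Suc n) ^ 2 \<le> (2 * real n + 1) ^ 2"
      by (intro power_mono) auto
    then show ?thesis
      by (simp add: abs_mult power_abs divide_inverse le_imp_inverse_le)
  qed
qed

end

theory Submission
  imports Defs "HOL-Real_Asymp.Real_Asymp"
begin

text \<open>
  Write \<open>w\<^sub>n = (2n choose n) / 4\<^sup>n\<close>. Since \<open>(2n+2 choose n+1)\<close> is a rational multiple of \<open>(2n choose n)\<close>,
  the summand is \<open>w\<^sub>n\<^sup>2\<close> times a rational function of \<open>n\<close>. Up to a telescoping part, its partial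
  fractions reduce to a multiple of \<open>w\<^sub>n\<^sup>2 / (2n+1)\<close>: lemma \<open>summand_decomposition\<close> gives an
  explicit \<open>U\<close> such that the summand is \<open>2 w\<^sub>n\<^sup>2 / (2n+1) + U\<^sub>n\<^sub>+\<^sub>1 - U\<^sub>n\<close>. Wallis' product yields
  \<open>(2n+1) w\<^sub>n\<^sup>2 \<longlonglongrightarrow> 2/\<pi>\<close>, hence \<open>U\<^sub>n \<longlonglongrightarrow> 20/\<pi>\<close>; this
  is the origin of \<open>20/\<pi>\<close>, while \<open>U\<^sub>0 = 8\<close> and the summand \<open>2/3\<close> at \<open>n = 0\<close> make up \<open>26/3\<close>.

  It remains to see that the sum of \<open>w\<^sub>n\<^sup>2 / (2n+1)\<close> is \<open>4G/\<pi>\<close> (lemma \<open>wallis_ratio_square_sums\<close>). One factor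
  \<open>w\<^sub>n\<close> is the mean of \<open>sin\<^sup>2\<^sup>n\<close> over \<open>[0, \<pi>/2]\<close>; the other factor, together with \<open>1/(2n+1)\<close>, is a
  coefficient of the arcsine series. Exchanging sum and integral turns the sum into \<open>2/\<pi>\<close> times the
  integral of \<open>arcsin (sin t) / sin t = t / sin t\<close> over \<open>[0, \<pi>/2]\<close>. This integral equals \<open>2G\<close>, because
  \<open>t / sin t\<close> has the antiderivative \<open>2 g (tan (t/2))\<close>, where \<open>g x\<close> is the sum of
  \<open>(-1)\<^sup>n x\<^sup>2\<^sup>n\<^sup>+\<^sup>1 / (2n+1)\<^sup>2\<close>, whose derivative is \<open>arctan x / x\<close> and whose value at \<open>1\<close> is \<open>G\<close>.
\<close>

section \<open>Normalised central binomial coefficients\<close>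

definition wallis_ratio :: "nat \<Rightarrow> real" where
  "wallis_ratio n = real ((2 * n) choose n) / 4 ^ n"

lemma wallis_ratio_0 [simp]: "wallis_ratio 0 = 1"
  by (simp add: wallis_ratio_def)

lemma central_binomial_Suc:
  "real ((2 * n + 2) choose (n + 1)) = real ((2 * n) choose n) * (2 * (2 * real n + 1) / (real n + 1))"
proof -
  have "real ((2 * n + 2) choose (n + 1)) = fact (2 * n + 2) / (fact (n + 1) * fact (n + 1))"
    by (subst binomial_fact) auto
  also have "\<dots> = fact (2 * n) / (fact n * fact n) * (2 * (2 * real n + 1) / (real n + 1))"
    by (simp add: divide_simps) (simp add: algebra_simps)
  also have "fact (2 * n) / (fact n * fact n) = real ((2 * n) choose n)"
    by (subst binomial_fact) auto
  finally show ?thesis .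
qed

lemma wallis_ratio_Suc:
  "wallis_ratio (Suc n) = wallis_ratio n * ((2 * real n + 1) / (2 * real n + 2))"
proof -
  have "wallis_ratio (Suc n) = real ((2 * n + 2) choose (n + 1)) / 4 ^ Suc n"
    by (simp add: wallis_ratio_def)
  also have "\<dots> = wallis_ratio n * ((2 * real n + 1) / (2 * real n + 2))"
    by (subst central_binomial_Suc) (simp add: wallis_ratio_def divide_simps, simp add: algebra_simps)
  finally show ?thesis .
qed

lemma wallis_ratio_pos: "wallis_ratio n > 0"
  by (simp add: wallis_ratio_def zero_less_binomial)

lemma wallis_ratio_le_1: "wallis_ratio n \<le> 1"
proof (induction n)
  case (Suc n)
  have "wallis_ratio n * ((2 * real n + 1) / (2 * real n + 2)) \<le> 1 * 1"
    using Suc wallis_ratio_pos[of n] by (intro mult_mono) auto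
  then show ?case by (simp add: wallis_ratio_Suc)
qed simp

text \<open>
  The partial products in Wallis' formula are exactly the reciprocals of this sequence.
\<close>
lemma wallis_ratio_square_tendsto:
  "(\<lambda>n. (2 * real n + 1) * wallis_ratio n ^ 2) \<longlonglongrightarrow> 2 / pi"
proof -
  have "(\<Prod>k=1..n. (4 * real k^2) / (4 * real k^2 - 1)) = inverse ((2 * real n + 1) * wallis_ratio n ^ 2)" for n
  proof (induction n)
    case (Suc n)
    have "4 * real (Suc n)^2 - 1 = (2 * real n + 1) * (2 * real n + 3)"
      by (simp add: power2_eq_square algebra_simps)
    moreover have "(\<Prod>k=1..Suc n. (4 * real k^2) / (4 * real k^2 - 1))
        = inverse ((2 * real n + 1) * wallis_ratio n ^ 2) * (4 * real (Suc n)^2 / (4 * real (Suc n)^2 - 1))"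
      by (subst prod.nat_ivl_Suc') (simp, simp only: Suc.IH mult.commute)
    moreover have "4 * real (Suc n)^2 = (2 * real n + 2)^2"
      by (simp add: power2_eq_square algebra_simps)
    ultimately have "(\<Prod>k=1..Suc n. (4 * real k^2) / (4 * real k^2 - 1))
        = inverse ((2 * real n + 1) * wallis_ratio n ^ 2)
          * ((2 * real n + 2)^2 / ((2 * real n + 1) * (2 * real n + 3)))"
      by metis
    also have "\<dots> = inverse ((2 * real (Suc n) + 1) * wallis_ratio (Suc n) ^ 2)"
      using wallis_ratio_pos[of n]
      by (simp add: wallis_ratio_Suc divide_simps power2_eq_square)
    finally show ?case .
  qed simp
  with wallis have "(\<lambda>n. inverse ((2 * real n + 1) * wallis_ratio n ^ 2)) \<longlonglongrightarrow> pi / 2"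
    by simp
  from tendsto_inverse[OF this] show ?thesis by simp
qed

lemma wallis_ratio_tendsto_0: "wallis_ratio \<longlonglongrightarrow> 0"
proof -
  have "(\<lambda>n. (2 * real n + 1) * wallis_ratio n ^ 2 * (1 / (2 * real n + 1))) \<longlonglongrightarrow> 2 / pi * 0"
    by (intro tendsto_mult wallis_ratio_square_tendsto) real_asymp
  also have "(\<lambda>n. (2 * real n + 1) * wallis_ratio n ^ 2 * (1 / (2 * real n + 1))) = (\<lambda>n. wallis_ratio n ^ 2)"
    by (simp add: fun_eq_iff divide_simps)
  finally have "(\<lambda>n. sqrt (wallis_ratio n ^ 2)) \<longlonglongrightarrow> sqrt 0"
    by (intro tendsto_real_sqrt) simp
  then show ?thesis
    using wallis_ratio_pos by (simp add: less_imp_le)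
qed

text \<open>
  The majorant that makes the arcsine series converge uniformly up to the endpoint \<open>1\<close>. Because
  \<open>w\<^sub>n - w\<^sub>n\<^sub>+\<^sub>1 = w\<^sub>n / (2n+2)\<close>, the terms are dominated by a telescoping series.
\<close>
lemma summable_wallis_ratio_div: "summable (\<lambda>n. wallis_ratio n / (2 * real n + 1))"
proof (rule summable_comparison_test')
  have "(\<lambda>n. wallis_ratio (Suc n) - wallis_ratio n) sums (0 - wallis_ratio 0)"
    by (rule telescope_sums[OF wallis_ratio_tendsto_0])
  from sums_mult[OF this, of "-2"]
  show "summable (\<lambda>n. -2 * (wallis_ratio (Suc n) - wallis_ratio n))"
    by (rule sums_summable)
  show "norm (wallis_ratio n / (2 * real n + 1)) \<le> -2 * (wallis_ratio (Suc n) - wallis_ratio n)" for n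
  proof -
    have "-2 * (wallis_ratio (Suc n) - wallis_ratio n) = wallis_ratio n / (real n + 1)"
      by (simp add: wallis_ratio_Suc divide_simps) (simp add: algebra_simps)
    then show ?thesis
      using wallis_ratio_pos[of n] by (simp add: frac_le)
  qed
qed

text \<open>
  The antiderivative \<open>- cos t sin\<^sup>2\<^sup>n\<^sup>+\<^sup>1 t\<close> vanishes at both endpoints; this is the usual reduction from
  exponent \<open>2n+2\<close> to \<open>2n\<close>, with the same factor as in \<open>wallis_ratio_Suc\<close>.
\<close>
lemma wallis_integral:
  "((\<lambda>t. sin t ^ (2 * n)) has_integral (pi / 2 * wallis_ratio n)) {0..pi/2}"
proof (induction n)
  case 0
  show ?case using has_integral_const_real[of "1::real" 0 "pi/2"] by simp
next
  case (Suc n)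
  have "((\<lambda>t. (2 * real n + 2) * sin t ^ (2 * n + 2) - (2 * real n + 1) * sin t ^ (2 * n)) has_integral
          (- cos (pi/2) * sin (pi/2) ^ (2 * n + 1)) - (- cos 0 * sin 0 ^ (2 * n + 1))) {0..pi/2}"
  proof (rule fundamental_theorem_of_calculus)
    fix t :: real
    have "(cos t)\<^sup>2 = 1 - (sin t)\<^sup>2"
      by (simp add: cos_squared_eq)
    then have "cos t * cos t = 1 - sin t * sin t" by (simp add: power2_eq_square)
    then have *: "cos t * cos t * sin t ^ (2 * n) = sin t ^ (2 * n) - sin t ^ (2 * n + 2)"
      by (simp only:) (simp add: algebra_simps)
    have "((\<lambda>t. - cos t * sin t ^ (2 * n + 1)) has_real_derivative
        sin t * sin t ^ (2 * n + 1) - (2 * real n + 1) * (cos t * cos t * sin t ^ (2 * n))) (at t within {0..pi/2})"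
      by (rule derivative_eq_intros refl | simp add: algebra_simps)+
    also have "sin t * sin t ^ (2 * n + 1) - (2 * real n + 1) * (cos t * cos t * sin t ^ (2 * n))
        = (2 * real n + 2) * sin t ^ (2 * n + 2) - (2 * real n + 1) * sin t ^ (2 * n)"
      by (subst *) (simp add: algebra_simps)
    finally show "((\<lambda>t. - cos t * sin t ^ (2 * n + 1)) has_vector_derivative
        (2 * real n + 2) * sin t ^ (2 * n + 2) - (2 * real n + 1) * sin t ^ (2 * n)) (at t within {0..pi/2})"
      by (simp add: has_real_derivative_iff_has_vector_derivative)
  qed simp
  from has_integral_mult_right[OF has_integral_add[OF this has_integral_mult_right[OF Suc, of "2 * real n + 1"]],
      of "1 / (2 * real n + 2)"]
  show ?case
    by (simp add: wallis_ratio_Suc mult_ac)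
qed

section \<open>Odd power series on the closed unit interval\<close>

text \<open>
  The primitive, vanishing at \<open>0\<close>, of the even series with coefficients \<open>c\<close>. It serves twice: for the arcsine
  (\<open>c = wallis_ratio\<close>) and for the primitive of \<open>arctan x / x\<close>. In both cases the derivative is known
  only inside the unit interval while the value at the endpoint \<open>1\<close> matters, so that termwise
  differentiation and continuity up to the boundary are separate facts.
\<close>
definition odd_series :: "(nat \<Rightarrow> real) \<Rightarrow> real \<Rightarrow> real" where
  "odd_series c x = (\<Sum>n. c n * x ^ (2 * n + 1) / (2 * real n + 1))"

lemma odd_series_0 [simp]: "odd_series c 0 = 0"
  by (simp add: odd_series_def)

lemma has_real_derivative_odd_series:
  assumes c: "\<And>n. \<bar>c n\<bar> \<le> 1" and x: "\<bar>x\<bar> < 1"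
  shows "(odd_series c has_real_derivative (\<Sum>n. c n * x ^ (2 * n))) (at x)"
proof -
  obtain r where r: "\<bar>x\<bar> < r" "r < 1"
    using dense[OF x] by blast
  have "uniformly_convergent_on {-r..r} (\<lambda>N y. \<Sum>n<N. c n * y ^ (2 * n))"
  proof (rule Weierstrass_m_test')
    fix n and y :: real assume "y \<in> {-r..r}"
    then have "\<bar>y\<bar> ^ (2 * n) \<le> r ^ (2 * n)" by (intro power_mono) auto
    then have "\<bar>c n\<bar> * \<bar>y\<bar> ^ (2 * n) \<le> 1 * r ^ (2 * n)"
      using c[of n] by (intro mult_mono) auto
    then show "norm (c n * y ^ (2 * n)) \<le> (r ^ 2) ^ n"
      by (simp add: abs_mult power_abs power_mult)
  next
    have "r\<^sup>2 < 1" using r by (simp add: abs_square_less_1)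
    then show "summable (\<lambda>n. (r ^ 2) ^ n)" by (intro summable_geometric) simp
  qed
  moreover have "((\<lambda>y. c n * y ^ (2 * n + 1) / (2 * real n + 1)) has_real_derivative c n * y ^ (2 * n))
      (at y within {-r..r})" for n y
    by (rule derivative_eq_intros refl | simp)+ (simp add: divide_simps)
  moreover have "summable (\<lambda>n. c n * 0 ^ (2 * n + 1) / (2 * real n + 1))" by simp
  moreover have "x \<in> interior {-r..r}" using r by auto
  moreover have "0 \<in> {-r..r}" using r by auto
  ultimately show ?thesis
    unfolding odd_series_def
    by (intro has_field_derivative_series'(2)[where S = "{-r..r}" and x = x and ?x0.0 = 0]) auto
qed

lemma continuous_on_odd_series:
  assumes "summable (\<lambda>n. \<bar>c n\<bar> / (2 * real n + 1))"
  shows "continuous_on {-1..1} (odd_series c)"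
proof (rule uniform_limit_theorem)
  show "uniform_limit {-1..1} (\<lambda>N x. \<Sum>n<N. c n * x ^ (2 * n + 1) / (2 * real n + 1)) (odd_series c) sequentially"
    unfolding odd_series_def
  proof (rule Weierstrass_m_test[OF _ assms])
    fix n and x :: real assume "x \<in> {-1..1}"
    then have "\<bar>x\<bar> ^ (2 * n + 1) \<le> 1" by (intro power_le_one) auto
    then have "\<bar>c n\<bar> * \<bar>x\<bar> ^ (2 * n + 1) \<le> \<bar>c n\<bar> * 1" by (intro mult_left_mono) auto
    then show "norm (c n * x ^ (2 * n + 1) / (2 * real n + 1)) \<le> \<bar>c n\<bar> / (2 * real n + 1)"
      by (simp add: abs_mult power_abs divide_right_mono)
  qed
qed (auto intro!: always_eventually continuous_intros)

section \<open>The arcsine series\<close>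

text \<open>
  The binomial series with exponent \<open>-1/2\<close> at \<open>-x\<^sup>2\<close>.
\<close>
lemma inverse_sqrt_series:
  fixes x :: real
  assumes "\<bar>x\<bar> < 1"
  shows "(\<Sum>n. wallis_ratio n * x ^ (2 * n)) = 1 / sqrt (1 - x\<^sup>2)"
proof -
  have coeff: "((-1/2) gchoose n) * (-1) ^ n = wallis_ratio n" for n
  proof (induction n)
    case (Suc n)
    have "((-1/2 :: real) gchoose Suc n) = ((-1/2) gchoose n) * ((-1/2 - real n) / (real n + 1))"
      by (simp add: gbinomial_prod_rev divide_simps)
    then have "((-1/2) gchoose Suc n) * (-1) ^ Suc n
        = (((-1/2) gchoose n) * (-1) ^ n) * - ((-1/2 - real n) / (real n + 1))"
      by simp
    also have "- ((-1/2 - real n) / (real n + 1)) = (2 * real n + 1) / (2 * real n + 2)"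
      by (simp add: divide_simps)
    finally show ?case by (simp only: Suc.IH wallis_ratio_Suc)
  qed simp
  have "x\<^sup>2 < 1" using assms by (simp add: abs_square_less_1)
  then have "(\<lambda>n. ((-1/2) gchoose n) * (-(x\<^sup>2)) ^ n) sums (1 + (-(x\<^sup>2))) powr (-1/2)"
    by (intro gen_binomial_real) simp
  moreover have "((-1/2) gchoose n) * (-(x\<^sup>2)) ^ n = wallis_ratio n * x ^ (2 * n)" for n
    by (subst coeff[symmetric]) (simp add: power_minus[of "x\<^sup>2"] power_mult)
  moreover have "(1 + (-(x\<^sup>2))) powr (-1/2) = 1 / sqrt (1 - x\<^sup>2)"
    using \<open>x\<^sup>2 < 1\<close> by (simp add: powr_minus_divide powr_half_sqrt)
  ultimately show ?thesis by (simp add: sums_iff)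
qed

text \<open>
  This is the arcsine series, in the form in which it is used: along \<open>sin\<close> the series has
  derivative \<open>cos t / cos t = 1\<close>, and continuity carries the identity to \<open>t = \<pi>/2\<close>.
\<close>
lemma odd_series_wallis_ratio_sin:
  assumes t: "0 \<le> t" "t \<le> pi / 2"
  shows "odd_series wallis_ratio (sin t) = t"
proof (cases "t = 0")
  case False
  define h where "h = (\<lambda>s. odd_series wallis_ratio (sin s) - s)"
  have "h t = h 0"
  proof (rule DERIV_isconst_end[of 0 t h])
    have "continuous_on {-1..1} (odd_series wallis_ratio)"
      using summable_wallis_ratio_div wallis_ratio_pos
      by (intro continuous_on_odd_series) (simp add: less_imp_le)
    then have "continuous_on {0..t} (\<lambda>s. odd_series wallis_ratio (sin s))"
      by (rule continuous_on_compose2) (auto intro!: continuous_intros)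
    then show "continuous_on {0..t} h"
      unfolding h_def by (intro continuous_intros)
  next
    fix s assume s: "0 < s" "s < t"
    then have cos: "cos s > 0" using t by (intro cos_gt_zero) auto
    have sq: "1 - (sin s)\<^sup>2 = (cos s)\<^sup>2" by (simp add: cos_squared_eq)
    have "(sin s)\<^sup>2 < 1" using sq cos by (smt (verit) zero_less_power)
    then have sin: "\<bar>sin s\<bar> < 1" by (simp add: abs_square_less_1)
    have "(odd_series wallis_ratio has_real_derivative 1 / cos s) (at (sin s))"
      using has_real_derivative_odd_series[of wallis_ratio "sin s"] sin cos
        wallis_ratio_pos wallis_ratio_le_1
      by (simp add: inverse_sqrt_series sq less_imp_le)
    from DERIV_chain2[OF this DERIV_sin]
    show "(h has_real_derivative 0) (at s)"
      unfolding h_def using cos by (auto intro!: derivative_eq_intros)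
  qed (use t False in auto)
  then show ?thesis by (simp add: h_def)
qed simp

section \<open>Catalan's constant as an integral\<close>

definition leibniz_coeff :: "nat \<Rightarrow> real" where
  "leibniz_coeff n = (-1) ^ n / (2 * real n + 1)"

lemma odd_series_leibniz_coeff_1: "odd_series leibniz_coeff 1 = catalan_constant"
  by (simp add: odd_series_def leibniz_coeff_def catalan_constant_def power2_eq_square)

lemma arctan_div_series:
  assumes "0 < x" "x < 1"
  shows "(\<Sum>n. leibniz_coeff n * x ^ (2 * n)) = arctan x / x"
proof -
  have x: "\<bar>x\<bar> \<le> 1" using assms by simp
  have "arctan x / x = (\<Sum>k. ((-1)^k * (1 / real (k*2+1) * x ^ (k*2+1))) / x)"
    using suminf_divide[OF summable_arctan_series[OF x], of x] arctan_series[OF x] by simp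
  also have "(\<lambda>k. ((-1)^k * (1 / real (k*2+1) * x ^ (k*2+1))) / x) = (\<lambda>n. leibniz_coeff n * x ^ (2 * n))"
    using assms by (auto simp: leibniz_coeff_def fun_eq_iff mult.commute)
  finally show ?thesis by simp
qed

text \<open>
  The substitution \<open>u = tan (t/2)\<close> turns \<open>t / sin t dt\<close> into \<open>2 arctan u / u du\<close> on \<open>[0, 1]\<close>. The series for
  \<open>arctan u / u\<close> has coefficients of size \<open>1/(2n+1)\<close>, so that termwise integration up to \<open>1\<close> has no summable
  majorant. The integrated series has one, hence is continuous on \<open>[0, 1]\<close>, and the fundamental theorem
  of calculus asks for its derivative only in the interior.
\<close>
lemma has_integral_t_div_sin:
  "((\<lambda>t. t / sin t) has_integral 2 * catalan_constant) {0..pi/2}"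
proof -
  have "((\<lambda>t. t / sin t) has_integral
      2 * odd_series leibniz_coeff (tan (pi / 2 / 2)) - 2 * odd_series leibniz_coeff (tan (0 / 2))) {0..pi/2}"
  proof (rule fundamental_theorem_of_calculus_interior)
    have summable_abs: "summable (\<lambda>n. \<bar>(-1) ^ n / (2 * real n + 1) ^ 2\<bar> :: real)"
    proof (rule summable_comparison_test')
      show "summable (\<lambda>n. inverse (real (Suc n) ^ 2))"
        using inverse_power_summable[of 2, where 'a = real] by (subst summable_Suc_iff) simp
      show "norm \<bar>(-1) ^ n / (2 * real n + 1) ^ 2 :: real\<bar> \<le> inverse (real (Suc n) ^ 2)" for n
      proof -
        have "real (Suc n) ^ 2 \<le> (2 * real n + 1) ^ 2" by (intro power_mono) auto
        then show ?thesis
          by (simp add: abs_mult power_abs divide_inverse le_imp_inverse_le)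
      qed
    qed
    have cos_nz: "cos (t / 2) \<noteq> 0" if "t \<in> {0..pi/2}" for t
    proof -
      have "0 \<le> t" "t \<le> pi / 2" using that by auto
      then have "cos (t / 2) > 0" using pi_gt_zero by (intro cos_gt_zero_pi) linarith+
      then show ?thesis by simp
    qed
    from summable_abs have "continuous_on {-1..1} (odd_series leibniz_coeff)"
      by (intro continuous_on_odd_series) (simp add: leibniz_coeff_def power2_eq_square abs_mult)
    moreover have "tan (t / 2) \<in> {-1..1}" if "t \<in> {0..pi/2}" for t
    proof -
      have "0 \<le> t" "t \<le> pi / 2" using that by auto
      have "tan (t / 2) \<le> tan (pi / 4)" using \<open>0 \<le> t\<close> \<open>t \<le> pi / 2\<close> pi_gt_zero by (intro tan_mono_le) linarith+
      moreover have "tan 0 \<le> tan (t / 2)" using \<open>0 \<le> t\<close> \<open>t \<le> pi / 2\<close> pi_gt_zero by (intro tan_mono_le) linarith+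
      ultimately show ?thesis by (simp add: tan_45)
    qed
    moreover have "continuous_on {0..pi/2} (\<lambda>t. tan (t / 2))"
      by (intro continuous_intros ballI cos_nz) auto
    ultimately show "continuous_on {0..pi/2} (\<lambda>t. 2 * odd_series leibniz_coeff (tan (t / 2)))"
      by (intro continuous_intros) (auto intro: continuous_on_compose2)
  next
    fix t :: real assume t: "t \<in> {0<..<pi/2}"
    have cos: "cos (t / 2) > 0" and sin: "sin (t / 2) > 0"
      using t by (auto intro!: cos_gt_zero_pi sin_gt_zero)
    have "tan (t / 2) < tan (pi / 4)" using t by (intro tan_monotone) auto
    then have lt1: "tan (t / 2) < 1" by (simp add: tan_45)
    have pos: "tan (t / 2) > 0" using sin cos by (simp add: tan_def)
    have arctan: "arctan (tan (t / 2)) = t / 2" using t by (intro arctan_tan) auto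
    have "\<bar>leibniz_coeff n\<bar> \<le> 1" for n by (simp add: leibniz_coeff_def)
    then have "(odd_series leibniz_coeff has_real_derivative t / 2 / tan (t / 2)) (at (tan (t / 2)))"
      using has_real_derivative_odd_series[of leibniz_coeff "tan (t / 2)"]
        arctan_div_series[OF pos lt1] arctan pos lt1 by simp
    moreover have "((\<lambda>t. tan (t / 2)) has_real_derivative inverse ((cos (t / 2))\<^sup>2) * (1 / 2)) (at t)"
      using cos by (auto intro!: derivative_eq_intros simp: divide_simps)
    ultimately have "((\<lambda>t. 2 * odd_series leibniz_coeff (tan (t / 2))) has_real_derivative
        2 * (t / 2 / tan (t / 2) * (inverse ((cos (t / 2))\<^sup>2) * (1 / 2)))) (at t)"
      by (intro DERIV_cmult DERIV_chain2[of "odd_series leibniz_coeff"])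
    also have "2 * (t / 2 / tan (t / 2) * (inverse ((cos (t / 2))\<^sup>2) * (1 / 2))) = t / (2 * sin (t / 2) * cos (t / 2))"
      using sin cos by (simp add: tan_def divide_simps power2_eq_square)
    also have "2 * sin (t / 2) * cos (t / 2) = sin t"
      using sin_double[of "t / 2"] by simp
    finally show "((\<lambda>t. 2 * odd_series leibniz_coeff (tan (t / 2))) has_vector_derivative t / sin t) (at t)"
      by (simp add: has_real_derivative_iff_has_vector_derivative)
  qed simp
  then show ?thesis
    by (simp add: tan_45 odd_series_leibniz_coeff_1)
qed

section \<open>Evaluation of the sum\<close>

text \<open>
  Integrate the series for \<open>arcsin (sin t) / sin t = t / sin t\<close> termwise: the integrals of the
  powers of \<open>sin\<close> supply the second factor \<open>w\<^sub>n\<close>.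
\<close>
lemma wallis_ratio_square_sums:
  "(\<lambda>n. wallis_ratio n ^ 2 / (2 * real n + 1)) sums (4 * catalan_constant / pi)"
proof -
  define f where "f = (\<lambda>n t. wallis_ratio n / (2 * real n + 1) * sin t ^ (2 * n))"
  have bound: "norm (f n t) \<le> wallis_ratio n / (2 * real n + 1)" for n t
  proof -
    have "\<bar>sin t\<bar> ^ (2 * n) \<le> 1" by (intro power_le_one) auto
    then have "wallis_ratio n / (2 * real n + 1) * \<bar>sin t\<bar> ^ (2 * n) \<le> wallis_ratio n / (2 * real n + 1) * 1"
      using wallis_ratio_pos[of n] by (intro mult_left_mono) auto
    then show ?thesis
      using wallis_ratio_pos[of n] by (simp add: f_def abs_mult power_abs)
  qed
  have "uniform_limit {0..pi/2} (\<lambda>N t. \<Sum>n<N. f n t) (\<lambda>t. \<Sum>n. f n t) sequentially"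
    using bound by (intro Weierstrass_m_test[OF _ summable_wallis_ratio_div])
  moreover have "continuous_on {0..pi/2} (\<lambda>t. \<Sum>n<N. f n t)" for N
    unfolding f_def by (intro continuous_intros)
  ultimately obtain I J where I: "\<And>N. ((\<lambda>t. \<Sum>n<N. f n t) has_integral I N) {0..pi/2}"
    and J: "((\<lambda>t. \<Sum>n. f n t) has_integral J) {0..pi/2}" and lim: "I \<longlonglongrightarrow> J"
    by (rule uniform_limit_integral) auto
  have "((\<lambda>t. \<Sum>n<N. f n t) has_integral (\<Sum>n<N. wallis_ratio n / (2 * real n + 1) * (pi / 2 * wallis_ratio n))) {0..pi/2}" for N
    unfolding f_def by (intro has_integral_sum has_integral_mult_right wallis_integral) auto
  from has_integral_unique[OF I this]
  have I_eq: "I N = (\<Sum>n<N. pi / 2 * (wallis_ratio n ^ 2 / (2 * real n + 1)))" for N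
    by (simp add: power2_eq_square mult_ac)
  have "((\<lambda>t. t / sin t) has_integral J) {0..pi/2}"
    \<comment> \<open>At \<open>t = 0\<close> the series has value \<open>1\<close>, whereas the quotient is \<open>0\<close> by convention.\<close>
  proof (rule has_integral_spike[OF negligible_sing[of 0] _ J])
    fix t assume t: "t \<in> {0..pi/2} - {0}"
    then have sin: "sin t > 0" by (intro sin_gt_zero) auto
    have "summable (\<lambda>n. f n t)"
      using bound by (intro summable_comparison_test'[OF summable_wallis_ratio_div])
    from suminf_mult[OF this, of "sin t"]
    have "sin t * (\<Sum>n. f n t) = odd_series wallis_ratio (sin t)"
      by (simp add: f_def odd_series_def mult_ac)
    also have "\<dots> = t" using t by (intro odd_series_wallis_ratio_sin) auto
    finally show "t / sin t = (\<Sum>n. f n t)" using sin by (simp add: field_simps)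
  qed
  then have "J = 2 * catalan_constant"
    using has_integral_t_div_sin has_integral_unique by blast
  with lim have "(\<lambda>n. pi / 2 * (wallis_ratio n ^ 2 / (2 * real n + 1))) sums (2 * catalan_constant)"
    unfolding sums_def I_eq[symmetric] by simp
  from sums_mult[OF this, of "2 / pi"]
  have "(\<lambda>n. 2 / pi * (pi / 2 * (wallis_ratio n ^ 2 / (2 * real n + 1)))) sums (2 / pi * (2 * catalan_constant))" .
  moreover have "2 / pi * (pi / 2 * x) = x" for x by simp
  ultimately show ?thesis by (simp only:) simp
qed

text \<open>
  The summand is \<open>w\<^sub>n\<^sup>2 (-4/(n+1) + 2/(n+1)\<^sup>2 + 8/(2n+3))\<close>. The function \<open>U\<close> adds up three telescoping relations,
  \<open>\<Delta>(n w\<^sub>n\<^sup>2) = w\<^sub>n\<^sup>2 / (4(n+1))\<close>, \<open>\<Delta>(w\<^sub>n\<^sup>2) = w\<^sub>n\<^sup>2 (1/(4(n+1)\<^sup>2) - 1/(n+1))\<close> and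
  \<open>\<Delta>(n\<^sup>2 w\<^sub>n\<^sup>2 / (2n+1)) = w\<^sub>n\<^sup>2 (1/(2n+3) - 1/(4(2n+1)))\<close>, with the weights \<open>16\<close>, \<open>8\<close>, \<open>8\<close> that remove
  all poles but the one at \<open>n = -1/2\<close>.
\<close>
lemma summand_decomposition:
  fixes U :: "nat \<Rightarrow> real"
  defines "U \<equiv> \<lambda>n. 8 * wallis_ratio n ^ 2 * (5 * real n ^ 2 + 4 * real n + 1) / (2 * real n + 1)"
  shows "real ((2 * n) choose n) * real ((2 * n + 2) choose (n + 1)) *
      (1 / (16 ^ n * (real n + 1) * (2 * real n + 1) * (2 * real n + 3)))
    = 2 * (wallis_ratio n ^ 2 / (2 * real n + 1)) + (U (Suc n) - U n)"
proof -
  have "real ((2 * n) choose n) = wallis_ratio n * 4 ^ n" by (simp add: wallis_ratio_def)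
  moreover have "(16 :: real) ^ n = 4 ^ n * 4 ^ n" by (simp flip: power_mult_distrib)
  ultimately have "real ((2 * n) choose n) * real ((2 * n + 2) choose (n + 1)) *
      (1 / (16 ^ n * (real n + 1) * (2 * real n + 1) * (2 * real n + 3)))
    = wallis_ratio n ^ 2 * (2 / ((real n + 1) ^ 2 * (2 * real n + 3)))"
    by (subst central_binomial_Suc) (simp add: divide_simps power2_eq_square)
  also have "2 / ((real n + 1) ^ 2 * (2 * real n + 3))
    = 2 / (2 * real n + 1)
      + (8 * ((2 * real n + 1) / (2 * real n + 2)) ^ 2 * (5 * (real n + 1) ^ 2 + 4 * (real n + 1) + 1) / (2 * real n + 3)
        - 8 * (5 * real n ^ 2 + 4 * real n + 1) / (2 * real n + 1))"
  proof -
    define x where "x = real n"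
    have "x \<ge> 0" by (simp add: x_def)
    then have nz: "x + 1 \<noteq> 0" "2 * x + 1 \<noteq> 0" "2 * x + 3 \<noteq> 0" "2 * x + 2 = 2 * (x + 1)" by auto
    show ?thesis
      unfolding x_def[symmetric] nz(4) power_divide power_mult_distrib using nz(1-3)
      by (simp add: divide_simps) (simp add: power2_eq_square; algebra)
  qed
  also have "wallis_ratio n ^ 2 * \<dots> = 2 * (wallis_ratio n ^ 2 / (2 * real n + 1)) + (U (Suc n) - U n)"
  proof -
    have [simp]: "2 * real (Suc n) + 1 = 2 * real n + 3" "real (Suc n) = real n + 1" by simp_all
    show ?thesis
      unfolding U_def wallis_ratio_Suc power_mult_distrib by (simp add: distrib_left right_diff_distrib mult_ac del: of_nat_Suc)
  qed
  finally show ?thesis .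
qed

theorem theorem3:
  shows "(\<lambda>k. let n = Suc k in
            real ((2 * n) choose n) * real ((2 * n + 2) choose (n + 1)) *
            (1 / (16 ^ n * (real n + 1) * (2 * real n + 1) * (2 * real n + 3))))
         sums (20 / pi + 8 * catalan_constant / pi - 26 / 3)"
proof -
  define T where "T = (\<lambda>n. real ((2 * n) choose n) * real ((2 * n + 2) choose (n + 1)) *
            (1 / (16 ^ n * (real n + 1) * (2 * real n + 1) * (2 * real n + 3))))"
  define U where "U = (\<lambda>n. 8 * wallis_ratio n ^ 2 * (5 * real n ^ 2 + 4 * real n + 1) / (2 * real n + 1))"
  \<comment> \<open>The rational factor of \<open>U\<close>, measured against \<open>(2n+1) w\<^sub>n\<^sup>2\<close>, tends to \<open>8 * 5 / 4 = 10\<close>.\<close>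
  have "(\<lambda>n. ((2 * real n + 1) * wallis_ratio n ^ 2) * (8 * (5 * real n ^ 2 + 4 * real n + 1) / (2 * real n + 1) ^ 2))
      \<longlonglongrightarrow> 2 / pi * 10"
    by (intro tendsto_mult wallis_ratio_square_tendsto) real_asymp
  also have "(\<lambda>n. ((2 * real n + 1) * wallis_ratio n ^ 2) * (8 * (5 * real n ^ 2 + 4 * real n + 1) / (2 * real n + 1) ^ 2)) = U"
    by (simp add: U_def fun_eq_iff divide_simps power2_eq_square)
  finally have "(\<lambda>n. U (Suc n) - U n) sums (20 / pi - U 0)"
    by (intro telescope_sums) simp
  from sums_add[OF sums_mult[OF wallis_ratio_square_sums, of 2] this]
  have "T sums (2 * (4 * catalan_constant / pi) + (20 / pi - U 0))"
    unfolding T_def summand_decomposition U_def .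
  then have "T sums (8 * catalan_constant / pi + (20 / pi - U 0))"
    by simp
  \<comment> \<open>The sum in question starts at \<open>n = 1\<close>, so the term \<open>T 0 = 2/3\<close> is taken off.\<close>
  then have "(\<lambda>k. T (Suc k)) sums (8 * catalan_constant / pi + (20 / pi - U 0) - T 0)"
    by (subst sums_Suc_iff) simp
  moreover have "U 0 = 8" "T 0 = 2 / 3" by (simp_all add: U_def T_def)
  ultimately show ?thesis by (simp add: T_def Let_def algebra_simps)
qed

end
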